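(* Let $\pi=2413\circledcirc\beta$, where $\beta$ is a 2413-balloon. Then $\mu[1,\pi]=2\,\mu[1,\beta]$.
   Context: Permutations are ordered by classical pattern containment ($\sigma\le\pi$ if $\pi$ has a subsequence order-isomorphic to $\sigma$), and $\mu[\sigma,\pi]$ is the Möbius function of this poset: $\mu[\sigma,\sigma]=1$, $\mu[\sigma,\pi]=0$ if $\sigma\not\le\pi$, and $\mu[\sigma,\pi]=-\sum_{\sigma\le\lambda<\pi}\mu[\sigma,\lambda]$ if $\sigma<\pi$. Here $1$ is the permutation of length one. For a non-empty permutation $\beta$ of length $b$, the 2413-balloon of $\beta$, written $2413\circledcirc\beta$, is the permutation of length $b+4$ given by $$2,\; b+4,\; \beta_1+2,\;\beta_2+2,\;\dots,\;\beta_b+2,\; 1,\; b+3.$$ A permutation is a 2413-balloon if it equals $2413\circledcirc\gamma$ for some non-empty permutation $\gamma$. *)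

theory Defs
  imports Main "HOL-Library.Sublist"
begin

text \<open>
  Permutations are written in one-line notation as lists: a permutation of length \<open>n\<close> is a list
  of length \<open>n\<close> in which each of the values \<open>1, \<dots>, n\<close> occurs exactly once.
\<close>

definition permutation :: "nat list \<Rightarrow> bool" where
  "permutation xs \<longleftrightarrow> distinct xs \<and> set xs = {1..length xs}"

definition order_isomorphic :: "nat list \<Rightarrow> nat list \<Rightarrow> bool" where
  "order_isomorphic xs ys \<longleftrightarrow>
     length xs = length ys \<and>
     (\<forall>i < length xs. \<forall>j < length xs. xs ! i < xs ! j \<longleftrightarrow> ys ! i < ys ! j)"

text \<open>
  Containment is a relation on permutations only, so that the set of all \<open>\<rho>\<close> with
  \<open>\<sigma> \<le> \<rho> < \<pi>\<close> contains nothing but permutations. Subsequences need not be contiguous.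
\<close>

definition contained :: "nat list \<Rightarrow> nat list \<Rightarrow> bool" where
  "contained \<sigma> \<pi> \<longleftrightarrow>
     permutation \<sigma> \<and> permutation \<pi> \<and> (\<exists>\<tau>. subseq \<tau> \<pi> \<and> order_isomorphic \<sigma> \<tau>)"

definition properly_contained :: "nat list \<Rightarrow> nat list \<Rightarrow> bool" where
  "properly_contained \<sigma> \<pi> \<longleftrightarrow> contained \<sigma> \<pi> \<and> \<sigma> \<noteq> \<pi>"

lemma permutation_nth_eq_card:
  assumes "permutation xs" "i < length xs"
  shows "xs ! i = Suc (card {j. j < length xs \<and> xs ! j < xs ! i})"
proof -
  let ?J = "{j. j < length xs \<and> xs ! j < xs ! i}"
  have d: "distinct xs" and s: "set xs = {1..length xs}"
    using assms(1) by (auto simp: permutation_def)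
  have i: "xs ! i \<in> {1..length xs}" using assms(2) s nth_mem by blast
  have "(!) xs ` ?J = {1..<xs ! i}"
  proof
    have "xs ! j \<ge> 1" if "j < length xs" for j
      using nth_mem[OF that] s by simp
    then show "(!) xs ` ?J \<subseteq> {1..<xs ! i}" by (auto simp: Suc_le_eq)
    show "{1..<xs ! i} \<subseteq> (!) xs ` ?J"
    proof
      fix v assume v: "v \<in> {1..<xs ! i}"
      then have "v \<in> set xs" using s i by auto
      then obtain j where "j < length xs" "xs ! j = v" by (auto simp: in_set_conv_nth)
      then show "v \<in> (!) xs ` ?J" using v by auto
    qed
  qed
  moreover have "inj_on ((!) xs) ?J"
    using d by (auto simp: inj_on_def nth_eq_iff_index_eq)
  ultimately have "card ?J = card {1..<xs ! i}" by (metis card_image)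
  then show ?thesis using i by simp
qed

lemma order_isomorphic_permutations_eq:
  assumes "permutation xs" "permutation ys" "order_isomorphic xs ys"
  shows "xs = ys"
proof (rule nth_equalityI)
  show len: "length xs = length ys" using assms(3) by (simp add: order_isomorphic_def)
  fix i assume i: "i < length xs"
  have "{j. j < length xs \<and> xs ! j < xs ! i} = {j. j < length ys \<and> ys ! j < ys ! i}"
    using assms(3) i unfolding order_isomorphic_def by auto
  then show "xs ! i = ys ! i"
    using permutation_nth_eq_card[OF assms(1) i] permutation_nth_eq_card[OF assms(2)] i len
    by simp
qed

lemma contained_length_le: "contained \<sigma> \<pi> \<Longrightarrow> length \<sigma> \<le> length \<pi>"
  by (auto simp: contained_def order_isomorphic_def dest: list_emb_length)

lemma properly_contained_length_less:
  assumes "properly_contained \<sigma> \<pi>"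
  shows "length \<sigma> < length \<pi>"
proof (rule ccontr)
  assume "\<not> length \<sigma> < length \<pi>"
  obtain \<tau> where \<tau>: "subseq \<tau> \<pi>" "order_isomorphic \<sigma> \<tau>"
    and p: "permutation \<sigma>" "permutation \<pi>" "\<sigma> \<noteq> \<pi>"
    using assms by (auto simp: properly_contained_def contained_def)
  with \<open>\<not> length \<sigma> < length \<pi>\<close> have "length \<tau> = length \<pi>"
    by (metis le_neq_implies_less list_emb_length order_isomorphic_def)
  with \<tau>(1) have "\<tau> = \<pi>" by (simp add: subseq_same_length)
  with \<tau>(2) p show False using order_isomorphic_permutations_eq by blast
qed

lemma finite_properly_contained: "finite {\<rho>. contained \<sigma> \<rho> \<and> properly_contained \<rho> \<pi>}"
proof (rule finite_subset)
  show "{\<rho>. contained \<sigma> \<rho> \<and> properly_contained \<rho> \<pi>}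
      \<subseteq> {xs. set xs \<subseteq> {1..length \<pi>} \<and> length xs \<le> length \<pi>}"
  proof (intro subsetI CollectI)
    fix xs assume "xs \<in> {\<rho>. contained \<sigma> \<rho> \<and> properly_contained \<rho> \<pi>}"
    then have "permutation xs" "length xs < length \<pi>"
      by (auto simp: contained_def properly_contained_length_less)
    then show "set xs \<subseteq> {1..length \<pi>} \<and> length xs \<le> length \<pi>"
      by (auto simp: permutation_def)
  qed
  show "finite {xs. set xs \<subseteq> {1..length \<pi>} \<and> length xs \<le> length \<pi>}"
    by (rule finite_lists_length_le) simp
qed

text \<open>
  The sum is over a finite set by \<open>finite_properly_contained\<close>.
\<close>

function moebius :: "nat list \<Rightarrow> nat list \<Rightarrow> int" where
  "moebius \<sigma> \<pi> =
     (if \<sigma> = \<pi> then 1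
      else if \<not> contained \<sigma> \<pi> then 0
      else - (\<Sum>\<rho> \<in> {\<rho>. contained \<sigma> \<rho> \<and> properly_contained \<rho> \<pi>}. moebius \<sigma> \<rho>))"
  by auto
termination
  by (relation "measure (\<lambda>(\<sigma>, \<pi>). length \<pi>)") (auto simp: properly_contained_length_less)

declare moebius.simps [simp del]

definition balloon :: "nat list \<Rightarrow> nat list" where
  "balloon \<beta> =
     [2, length \<beta> + 4] @ map (\<lambda>v. v + 2) \<beta> @ [1, length \<beta> + 3]"

definition is_balloon :: "nat list \<Rightarrow> bool" where
  "is_balloon \<pi> \<longleftrightarrow> (\<exists>\<gamma>. permutation \<gamma> \<and> \<gamma> \<noteq> [] \<and> \<pi> = balloon \<gamma>)"

lemma permutation_balloon:
  assumes "permutation \<beta>"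
  shows "permutation (balloon \<beta>)"
proof -
  have d: "distinct \<beta>" and s: "set \<beta> = {1..length \<beta>}"
    using assms by (auto simp: permutation_def)
  have "(\<lambda>v. v + 2) ` set \<beta> = {3..length \<beta> + 2}"
    unfolding s using image_add_atLeastAtMost'[of 2 1 "length \<beta>"] by simp
  then have "set (balloon \<beta>) = {1..length (balloon \<beta>)}" by (auto simp: balloon_def)
  moreover from this have "card (set (balloon \<beta>)) = length (balloon \<beta>)" by simp
  then have "distinct (balloon \<beta>)" by (rule card_distinct)
  ultimately show ?thesis by (simp add: permutation_def)
qed

end

theory Submission
  imports Defs
begin

text \<open>
  The number \<open>2\<close> in the theorem comes from applying one summation formula twice.

  Write \<open>addL\<close>, \<open>addT\<close>, \<open>addR\<close>, \<open>addB\<close> for the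
  maps sending \<open>\<rho>\<close> to \<open>1 \<oplus> \<rho>\<close>, \<open>1 \<ominus> \<rho>\<close>, \<open>\<rho> \<oplus> 1\<close>,
  \<open>\<rho> \<ominus> 1\<close>. Deleting at least one of the four outer points of
  \<open>balloon \<beta>\<close> gives a permutation \<open>\<beta>\<^sub>X\<close> obtained from \<open>\<beta>\<close> by such maps; here \<open>X\<close>
  is the set of outer points kept. Put \<open>\<beta>\<^sub>X = balloon \<beta>\<close> when all four are kept.
  The empty permutation is included as a bottom element throughout, so that \<open>2413\<close> is the balloon
  of the empty permutation.

  The combinatorial core is lemma \<open>corner_sum_contained\<close>: for \<open>\<beta>\<close> non-empty and every
  permutation \<open>\<sigma>\<close>, the alternating sum over \<open>X\<close> of \<open>(-1)\<^sup>|\<^sup>X\<^sup>|\<close> times the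
  truth value of \<open>\<sigma> \<le> \<beta>\<^sub>X\<close> is \<open>1\<close> if \<open>\<sigma> = balloon \<beta>'\<close> with
  \<open>\<beta>' \<le> \<beta>\<close> and \<open>\<sigma> \<not>\<le> \<beta>\<close>, and \<open>0\<close> otherwise. The reason is that a
  direct sum cannot use a point added by a skew sum, and vice versa, so that most terms of the
  alternating sum cancel in pairs.

  Multiplying by an arbitrary \<open>g \<sigma>\<close> and summing over \<open>\<sigma>\<close> gives, for
  \<open>G \<rho> = (\<Sum>\<sigma> \<le> \<rho>. g \<sigma>)\<close>, a formula expressing the alternating sum of
  \<open>G \<beta>\<^sub>X\<close> through the values of \<open>g\<close> on balloons (\<open>corner_sum_downset_sum\<close>).
  Let \<open>f = \<mu>[1, \<cdot>]\<close>, \<open>h = f \<circ> balloon\<close>, and let \<open>N g \<beta>\<close> be the sum of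
  \<open>g \<beta>'\<close> over all \<open>\<beta>' \<le> \<beta>\<close> with \<open>balloon \<beta>' \<not>\<le> \<beta>\<close>.

  Take \<open>g = f\<close>. Then \<open>G\<close> is the indicator of the permutation \<open>1\<close>, so \<open>N h \<beta> = 0\<close>
  for all \<open>\<beta>\<close> of length at least two.

  Take \<open>g = h\<close>. Then \<open>G \<rho> = N h \<rho> + K \<rho>\<close>, where \<open>K \<rho>\<close> sums \<open>h \<beta>'\<close> over the
  \<open>\<beta>'\<close> with \<open>balloon \<beta>' \<le> \<rho>\<close>. Balloons are indecomposable, so
  \<open>K \<beta>\<^sub>X = K \<beta>\<close> unless all four points are kept, and then \<open>K (balloon \<beta>) = G \<beta>\<close>.
  The alternating sum of \<open>K\<close> is therefore \<open>G \<beta> - K \<beta> = N h \<beta>\<close>, and that of \<open>N h\<close>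
  is \<open>N h \<beta>\<close> again, up to corrections at the empty permutation. Hence
  \<open>N (h \<circ> balloon) \<beta> = 2 * N h \<beta>\<close> (\<open>balloon_sum_double_balloon\<close>), and induction on the
  length of \<open>\<beta>\<close> isolates the term at \<open>\<beta>\<close> itself: \<open>h (balloon \<beta>) = 2 * h \<beta>\<close>.
\<close>

section \<open>Standardization and the containment order\<close>

definition standardize :: "nat list \<Rightarrow> nat list" where
  "standardize xs = map (\<lambda>v. card {w \<in> set xs. w \<le> v}) xs"

lemma length_standardize [simp]: "length (standardize xs) = length xs"
  by (simp add: standardize_def)

lemma rank_strict_mono:
  "strict_mono_on (set xs) (\<lambda>v. card {w \<in> set xs. w \<le> v})" for xs :: "nat list"
proof (rule strict_mono_onI)
  fix u v :: nat
  assume "u \<in> set xs" "v \<in> set xs" "u < v"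
  then have "{w \<in> set xs. w \<le> u} \<subseteq> {w \<in> set xs. w \<le> v}"
    "v \<in> {w \<in> set xs. w \<le> v} - {w \<in> set xs. w \<le> u}" by auto
  then have "{w \<in> set xs. w \<le> u} \<subset> {w \<in> set xs. w \<le> v}" by blast
  then show "card {w \<in> set xs. w \<le> u} < card {w \<in> set xs. w \<le> v}"
    by (intro psubset_card_mono) auto
qed

lemma order_isomorphic_map:
  assumes "strict_mono_on (set xs) r"
  shows "order_isomorphic xs (map r xs)"
  using strict_mono_on_less[OF assms] by (simp add: order_isomorphic_def)

lemma order_isomorphic_trans_sym:
  "order_isomorphic xs zs \<Longrightarrow> order_isomorphic ys zs \<Longrightarrow> order_isomorphic xs ys"
  by (simp add: order_isomorphic_def)

lemma order_isomorphic_standardize: "order_isomorphic xs (standardize xs)"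
  unfolding standardize_def by (rule order_isomorphic_map[OF rank_strict_mono])

lemma order_isomorphic_sym: "order_isomorphic xs ys \<Longrightarrow> order_isomorphic ys xs"
  by (simp add: order_isomorphic_def)

lemma permutation_standardize:
  assumes "distinct xs"
  shows "permutation (standardize xs)"
proof -
  let ?r = "\<lambda>v. card {w \<in> set xs. w \<le> v}"
  have inj: "inj_on ?r (set xs)"
    using rank_strict_mono by (rule strict_mono_on_imp_inj_on)
  have "?r ` set xs \<subseteq> {1..length xs}"
  proof clarify
    fix v assume "v \<in> set xs"
    then have "{w \<in> set xs. w \<le> v} \<noteq> {}" by auto
    moreover have "?r v \<le> card (set xs)" by (rule card_mono) auto
    ultimately show "?r v \<in> {1..length xs}"
      using assms by (simp add: distinct_card Suc_le_eq card_gt_0_iff)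
  qed
  moreover have "card (?r ` set xs) = card {1..length xs}"
    using inj assms by (simp add: card_image distinct_card)
  ultimately have "?r ` set xs = {1..length xs}"
    by (simp add: card_subset_eq)
  then show ?thesis
    using inj assms by (simp add: permutation_def standardize_def distinct_map)
qed

lemma standardize_permutation: "permutation xs \<Longrightarrow> standardize xs = xs"
  by (metis order_isomorphic_permutations_eq order_isomorphic_standardize order_isomorphic_sym
      permutation_def permutation_standardize)

lemma standardize_map:
  assumes "strict_mono_on (set xs) r"
  shows "standardize (map r xs) = standardize xs"
proof -
  have "card {w \<in> r ` set xs. w \<le> r v} = card {w \<in> set xs. w \<le> v}" if "v \<in> set xs" for v
  proof -
    have "{w \<in> r ` set xs. w \<le> r v} = r ` {w \<in> set xs. w \<le> v}"
      using strict_mono_on_less_eq[OF assms] that by auto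
    moreover have "inj_on r {w \<in> set xs. w \<le> v}"
      using strict_mono_on_imp_inj_on[OF assms] by (rule inj_on_subset) auto
    ultimately show ?thesis by (simp add: card_image)
  qed
  then show ?thesis by (simp add: standardize_def)
qed

lemma permutation_distinct: "permutation xs \<Longrightarrow> distinct xs"
  by (simp add: permutation_def)

lemma subseq_distinct: "subseq xs ys \<Longrightarrow> distinct ys \<Longrightarrow> distinct xs"
  by (auto simp: subseq_conv_nths distinct_nthsI)

text \<open>
  Replacing the order-isomorphism in the definition of containment by the function
  \<open>standardize\<close> turns every containment question below into a computation with subsequences.
\<close>

lemma contained_iff_standardize:
  assumes "permutation \<pi>"
  shows "contained \<sigma> \<pi> \<longleftrightarrow> (\<exists>\<tau>. subseq \<tau> \<pi> \<and> \<sigma> = standardize \<tau>)"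
proof
  assume "contained \<sigma> \<pi>"
  then obtain \<tau> where *: "permutation \<sigma>" "subseq \<tau> \<pi>" "order_isomorphic \<sigma> \<tau>"
    by (auto simp: contained_def)
  then have "distinct \<tau>"
    using assms permutation_distinct subseq_distinct by blast
  then have "\<sigma> = standardize \<tau>"
    using * order_isomorphic_permutations_eq permutation_standardize order_isomorphic_standardize
      order_isomorphic_sym order_isomorphic_trans_sym by metis
  with * show "\<exists>\<tau>. subseq \<tau> \<pi> \<and> \<sigma> = standardize \<tau>" by blast
next
  assume "\<exists>\<tau>. subseq \<tau> \<pi> \<and> \<sigma> = standardize \<tau>"
  then show "contained \<sigma> \<pi>"
    using assms permutation_standardize subseq_distinct permutation_distinct
      order_isomorphic_standardize order_isomorphic_sym
    unfolding contained_def by metis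
qed

lemma contained_standardize:
  assumes "subseq \<tau> \<xi>" "distinct \<xi>"
  shows "contained (standardize \<tau>) (standardize \<xi>)"
proof -
  let ?r = "\<lambda>v. card {w \<in> set \<xi>. w \<le> v}"
  have sub: "subseq (map ?r \<tau>) (standardize \<xi>)"
    unfolding standardize_def using assms(1) by (rule subseq_map)
  have "set \<tau> \<subseteq> set \<xi>"
    using assms(1) by (auto simp: subseq_conv_nths dest: in_set_nthsD)
  then have "strict_mono_on (set \<tau>) ?r"
    using rank_strict_mono monotone_on_subset by blast
  then have "standardize (map ?r \<tau>) = standardize \<tau>"
    by (rule standardize_map)
  with sub show ?thesis
    using assms(2) by (metis contained_iff_standardize permutation_standardize)
qed

lemma contained_refl: "permutation \<pi> \<Longrightarrow> contained \<pi> \<pi>"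
  by (metis contained_iff_standardize standardize_permutation subseq_order.order_refl)

lemma contained_trans:
  assumes "contained \<rho> \<sigma>" "contained \<sigma> \<pi>"
  shows "contained \<rho> \<pi>"
proof -
  have perm: "permutation \<sigma>" "permutation \<pi>" using assms by (auto simp: contained_def)
  obtain \<tau> where \<tau>: "subseq \<tau> \<pi>" "\<sigma> = standardize \<tau>"
    using assms(2) contained_iff_standardize perm(2) by blast
  let ?r = "\<lambda>v. card {w \<in> set \<tau>. w \<le> v}"
  obtain \<upsilon> where "subseq \<upsilon> (map ?r \<tau>)" "\<rho> = standardize \<upsilon>"
    using assms(1) contained_iff_standardize perm(1) \<tau>(2) unfolding standardize_def by blast
  then obtain A where A: "\<upsilon> = map ?r (nths \<tau> A)"
    by (auto simp: subseq_conv_nths nths_map)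
  have "strict_mono_on (set (nths \<tau> A)) ?r"
    by (rule monotone_on_subset[OF rank_strict_mono set_nths_subset])
  then have "\<rho> = standardize (nths \<tau> A)"
    using \<open>\<rho> = standardize \<upsilon>\<close> A standardize_map by simp
  moreover have "subseq (nths \<tau> A) \<pi>"
    using \<tau>(1) subseq_conv_nths subseq_order.order_trans by blast
  ultimately show ?thesis
    using contained_iff_standardize perm(2) by blast
qed

section \<open>Adding one extreme point\<close>

text \<open>
  The four outer points of a balloon are its leftmost, topmost, rightmost and bottommost point; relative to
  the interior they lie at the lower left, upper left, upper right and lower right. Adding them one at a time
  gives \<open>1 \<oplus> \<rho>\<close>, \<open>1 \<ominus> \<rho>\<close>, \<open>\<rho> \<oplus> 1\<close> and \<open>\<rho> \<ominus> 1\<close>.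
\<close>

definition addL :: "nat list \<Rightarrow> nat list" where "addL \<rho> = 1 # map Suc \<rho>"
definition addT :: "nat list \<Rightarrow> nat list" where "addT \<rho> = Suc (length \<rho>) # \<rho>"
definition addR :: "nat list \<Rightarrow> nat list" where "addR \<rho> = \<rho> @ [Suc (length \<rho>)]"
definition addB :: "nat list \<Rightarrow> nat list" where "addB \<rho> = map Suc \<rho> @ [1]"

lemmas add_defs = addL_def addT_def addR_def addB_def

lemma length_add [simp]:
  "length (addL \<rho>) = Suc (length \<rho>)" "length (addT \<rho>) = Suc (length \<rho>)"
  "length (addR \<rho>) = Suc (length \<rho>)" "length (addB \<rho>) = Suc (length \<rho>)"
  by (simp_all add: add_defs)

lemma permutation_add [simp]:
  assumes "permutation \<rho>"
  shows "permutation (addL \<rho>)" "permutation (addT \<rho>)"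
    "permutation (addR \<rho>)" "permutation (addB \<rho>)"
proof -
  have d: "distinct \<rho>" "distinct (map Suc \<rho>)" and s: "set \<rho> = {1..length \<rho>}"
    using assms by (simp_all add: permutation_def distinct_map)
  have "set (map Suc \<rho>) = {Suc 1..Suc (length \<rho>)}"
    by (simp only: set_map s image_Suc_atLeastAtMost)
  moreover have "insert 1 {Suc 1..Suc (length \<rho>)} = {1..Suc (length \<rho>)}"
    "insert (Suc (length \<rho>)) {1..length \<rho>} = {1..Suc (length \<rho>)}" by auto
  ultimately show "permutation (addL \<rho>)" "permutation (addB \<rho>)"
    "permutation (addT \<rho>)" "permutation (addR \<rho>)"
    using d s by (simp_all add: permutation_def add_defs)
qed

lemma standardize_Cons_min:
  assumes "\<forall>x \<in> set xs. a < x"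
  shows "standardize (a # xs) = addL (standardize xs)"
proof -
  have "{w \<in> set (a # xs). w \<le> a} = {a}" using assms by auto
  moreover have "card {w \<in> set (a # xs). w \<le> v} = Suc (card {w \<in> set xs. w \<le> v})"
    if "v \<in> set xs" for v
  proof -
    have "{w \<in> set (a # xs). w \<le> v} = insert a {w \<in> set xs. w \<le> v}" using assms that by auto
    moreover have "a \<notin> set xs" using assms by auto
    ultimately show ?thesis by simp
  qed
  ultimately show ?thesis by (simp add: standardize_def addL_def)
qed

lemma standardize_append_min:
  assumes "\<forall>x \<in> set xs. a < x"
  shows "standardize (xs @ [a]) = addB (standardize xs)"
proof -
  have "{w \<in> set (xs @ [a]). w \<le> a} = {a}" using assms by auto
  moreover have "card {w \<in> set (xs @ [a]). w \<le> v} = Suc (card {w \<in> set xs. w \<le> v})"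
    if "v \<in> set xs" for v
  proof -
    have "{w \<in> set (xs @ [a]). w \<le> v} = insert a {w \<in> set xs. w \<le> v}" using assms that by auto
    moreover have "a \<notin> set xs" using assms by auto
    ultimately show ?thesis by simp
  qed
  ultimately show ?thesis by (simp add: standardize_def addB_def)
qed

lemma standardize_Cons_max:
  assumes "\<forall>x \<in> set xs. x < a" "distinct xs"
  shows "standardize (a # xs) = addT (standardize xs)"
proof -
  have "{w \<in> set (a # xs). w \<le> a} = insert a (set xs)" using assms by auto
  then have "card {w \<in> set (a # xs). w \<le> a} = Suc (length xs)"
    using assms by (auto simp: distinct_card)
  moreover have "{w \<in> set (a # xs). w \<le> v} = {w \<in> set xs. w \<le> v}"
    if "v \<in> set xs" for v using assms that by auto
  ultimately show ?thesis by (simp add: standardize_def addT_def)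
qed

lemma standardize_append_max:
  assumes "\<forall>x \<in> set xs. x < a" "distinct xs"
  shows "standardize (xs @ [a]) = addR (standardize xs)"
proof -
  have "{w \<in> set (xs @ [a]). w \<le> a} = insert a (set xs)" using assms by auto
  then have "card {w \<in> set (xs @ [a]). w \<le> a} = Suc (length xs)"
    using assms by (auto simp: distinct_card)
  moreover have "{w \<in> set (xs @ [a]). w \<le> v} = {w \<in> set xs. w \<le> v}"
    if "v \<in> set xs" for v using assms that by auto
  ultimately show ?thesis by (simp add: standardize_def addR_def)
qed

lemma standardize_balloon:
  assumes "c < a" "\<forall>x \<in> set xs. a < x \<and> x < d" "a < d" "d < b" "distinct xs"
  shows "standardize ([a, b] @ xs @ [c, d]) = balloon (standardize xs)"
proof -
  let ?S = "set ([a, b] @ xs @ [c, d])"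
  have "{w \<in> ?S. w \<le> a} = {a, c}" "{w \<in> ?S. w \<le> c} = {c}"
    using assms by auto
  then have ac: "card {w \<in> ?S. w \<le> a} = 2" "card {w \<in> ?S. w \<le> c} = 1"
    using assms by auto
  have "{w \<in> ?S. w \<le> d} = insert a (insert c (insert d (set xs)))"
    "{w \<in> ?S. w \<le> b} = insert b (insert a (insert c (insert d (set xs))))"
    using assms by auto
  moreover have "a \<notin> set xs" "c \<notin> set xs" "d \<notin> set xs" "b \<notin> set xs"
    using assms by auto
  ultimately have bd: "card {w \<in> ?S. w \<le> d} = length xs + 3" "card {w \<in> ?S. w \<le> b} = length xs + 4"
    using assms by (auto simp: distinct_card)
  have "card {w \<in> ?S. w \<le> v} = card {w \<in> set xs. w \<le> v} + 2" if "v \<in> set xs" for v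
  proof -
    have "{w \<in> ?S. w \<le> v} = insert a (insert c {w \<in> set xs. w \<le> v})"
      using assms that by auto
    moreover have "a \<notin> set xs" "c \<notin> set xs" using assms by auto
    ultimately show ?thesis using assms by simp
  qed
  with ac bd show ?thesis by (simp add: standardize_def balloon_def)
qed

lemma strict_mono_on_Suc [simp]: "strict_mono_on A Suc"
  by (simp add: strict_mono_on_def)

lemma subseq_map_iff: "subseq \<tau> (map f xs) \<longleftrightarrow> (\<exists>\<upsilon>. subseq \<upsilon> xs \<and> \<tau> = map f \<upsilon>)"
  by (auto simp: subseq_conv_nths nths_map)

lemma subseq_Cons_iff:
  "subseq \<tau> (x # xs) \<longleftrightarrow> subseq \<tau> xs \<or> (\<exists>\<upsilon>. subseq \<upsilon> xs \<and> \<tau> = x # \<upsilon>)"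
  by (auto elim: list_emb.cases)

lemma subseq_snoc_iff:
  "subseq \<tau> (xs @ [x]) \<longleftrightarrow> subseq \<tau> xs \<or> (\<exists>\<upsilon>. subseq \<upsilon> xs \<and> \<tau> = \<upsilon> @ [x])"
proof
  assume "subseq \<tau> (xs @ [x])"
  then obtain A where "\<tau> = nths xs A @ nths [x] {j. j + length xs \<in> A}"
    by (auto simp: subseq_conv_nths nths_append)
  then have "\<tau> = nths xs A \<or> \<tau> = nths xs A @ [x]"
    by (simp split: if_splits)
  moreover have "subseq (nths xs A) xs"
    using subseq_conv_nths by blast
  ultimately show "subseq \<tau> xs \<or> (\<exists>\<upsilon>. subseq \<upsilon> xs \<and> \<tau> = \<upsilon> @ [x])" by metis
qed (auto intro: list_emb_append_mono)

lemma subseq_set: "subseq xs ys \<Longrightarrow> set xs \<subseteq> set ys"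
  by (auto simp: subseq_conv_nths dest: in_set_nthsD)

lemma contained_permutation:
  "contained \<sigma> \<pi> \<Longrightarrow> permutation \<sigma>" "contained \<sigma> \<pi> \<Longrightarrow> permutation \<pi>"
  by (auto simp: contained_def)

lemma permutation_range: "permutation xs \<Longrightarrow> x \<in> set xs \<Longrightarrow> 0 < x \<and> x \<le> length xs"
  by (auto simp: permutation_def)

text \<open>
  An occurrence of \<open>\<sigma>\<close> in a permutation with one added extreme point either avoids that
  point, or uses it as the corresponding extreme point of \<open>\<sigma>\<close>.
\<close>

lemma contained_addL_iff:
  assumes "permutation \<rho>"
  shows "contained \<sigma> (addL \<rho>) \<longleftrightarrow> contained \<sigma> \<rho> \<or> (\<exists>\<sigma>'. contained \<sigma>' \<rho> \<and> \<sigma> = addL \<sigma>')"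
    (is "?A \<longleftrightarrow> ?B \<or> ?C")
proof -
  have std: "standardize (map Suc \<tau>) = standardize \<tau>"
    "standardize (1 # map Suc \<tau>) = addL (standardize \<tau>)" if "subseq \<tau> \<rho>" for \<tau>
    using permutation_range[OF assms] subseq_set[OF that]
    by (auto simp: standardize_map standardize_Cons_min subset_eq)
  have "?A \<longleftrightarrow> (\<exists>\<tau>. subseq \<tau> (addL \<rho>) \<and> \<sigma> = standardize \<tau>)"
    using assms by (simp add: contained_iff_standardize)
  also have "\<dots> \<longleftrightarrow> (\<exists>\<tau>. subseq \<tau> \<rho> \<and>
      (\<sigma> = standardize (map Suc \<tau>) \<or> \<sigma> = standardize (1 # map Suc \<tau>)))"
    unfolding addL_def subseq_Cons_iff subseq_map_iff by blast
  also have "\<dots> \<longleftrightarrow> ?B \<or> ?C"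
    using assms std by (fastforce simp: contained_iff_standardize)
  finally show ?thesis .
qed

lemma contained_addT_iff:
  assumes "permutation \<rho>"
  shows "contained \<sigma> (addT \<rho>) \<longleftrightarrow> contained \<sigma> \<rho> \<or> (\<exists>\<sigma>'. contained \<sigma>' \<rho> \<and> \<sigma> = addT \<sigma>')"
    (is "?A \<longleftrightarrow> ?B \<or> ?C")
proof -
  have std: "standardize (Suc (length \<rho>) # \<tau>) = addT (standardize \<tau>)" if "subseq \<tau> \<rho>" for \<tau>
    using permutation_range[OF assms] subseq_set[OF that] that assms
    by (intro standardize_Cons_max) (auto simp: subset_eq permutation_distinct subseq_distinct less_Suc_eq_le)
  have "?A \<longleftrightarrow> (\<exists>\<tau>. subseq \<tau> (addT \<rho>) \<and> \<sigma> = standardize \<tau>)"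
    using assms by (simp add: contained_iff_standardize)
  also have "\<dots> \<longleftrightarrow> (\<exists>\<tau>. subseq \<tau> \<rho> \<and>
      (\<sigma> = standardize \<tau> \<or> \<sigma> = standardize (Suc (length \<rho>) # \<tau>)))"
    unfolding addT_def subseq_Cons_iff by blast
  also have "\<dots> \<longleftrightarrow> ?B \<or> ?C"
    using assms std by (fastforce simp: contained_iff_standardize)
  finally show ?thesis .
qed

lemma contained_addR_iff:
  assumes "permutation \<rho>"
  shows "contained \<sigma> (addR \<rho>) \<longleftrightarrow> contained \<sigma> \<rho> \<or> (\<exists>\<sigma>'. contained \<sigma>' \<rho> \<and> \<sigma> = addR \<sigma>')"
    (is "?A \<longleftrightarrow> ?B \<or> ?C")
proof -
  have std: "standardize (\<tau> @ [Suc (length \<rho>)]) = addR (standardize \<tau>)" if "subseq \<tau> \<rho>" for \<tau>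
    using permutation_range[OF assms] subseq_set[OF that] that assms
    by (intro standardize_append_max) (auto simp: subset_eq permutation_distinct subseq_distinct less_Suc_eq_le)
  have "?A \<longleftrightarrow> (\<exists>\<tau>. subseq \<tau> (addR \<rho>) \<and> \<sigma> = standardize \<tau>)"
    using assms by (simp add: contained_iff_standardize)
  also have "\<dots> \<longleftrightarrow> (\<exists>\<tau>. subseq \<tau> \<rho> \<and>
      (\<sigma> = standardize \<tau> \<or> \<sigma> = standardize (\<tau> @ [Suc (length \<rho>)])))"
    unfolding addR_def subseq_snoc_iff by blast
  also have "\<dots> \<longleftrightarrow> ?B \<or> ?C"
    using assms std by (fastforce simp: contained_iff_standardize)
  finally show ?thesis .
qed

lemma contained_addB_iff:
  assumes "permutation \<rho>"
  shows "contained \<sigma> (addB \<rho>) \<longleftrightarrow> contained \<sigma> \<rho> \<or> (\<exists>\<sigma>'. contained \<sigma>' \<rho> \<and> \<sigma> = addB \<sigma>')"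
    (is "?A \<longleftrightarrow> ?B \<or> ?C")
proof -
  have std: "standardize (map Suc \<tau>) = standardize \<tau>"
    "standardize (map Suc \<tau> @ [1]) = addB (standardize \<tau>)" if "subseq \<tau> \<rho>" for \<tau>
    using permutation_range[OF assms] subseq_set[OF that]
    by (auto simp: standardize_map standardize_append_min subset_eq)
  have "?A \<longleftrightarrow> (\<exists>\<tau>. subseq \<tau> (addB \<rho>) \<and> \<sigma> = standardize \<tau>)"
    using assms by (simp add: contained_iff_standardize)
  also have "\<dots> \<longleftrightarrow> (\<exists>\<tau>. subseq \<tau> \<rho> \<and>
      (\<sigma> = standardize (map Suc \<tau>) \<or> \<sigma> = standardize (map Suc \<tau> @ [1])))"
    unfolding addB_def subseq_snoc_iff subseq_map_iff by blast
  also have "\<dots> \<longleftrightarrow> ?B \<or> ?C"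
    using assms std by (fastforce simp: contained_iff_standardize)
  finally show ?thesis .
qed

lemmas contained_add_iff = contained_addL_iff contained_addT_iff contained_addR_iff contained_addB_iff

lemma contained_addI:
  assumes "contained \<sigma> \<rho>"
  shows "contained \<sigma> (addL \<rho>)" "contained \<sigma> (addT \<rho>)" "contained \<sigma> (addR \<rho>)" "contained \<sigma> (addB \<rho>)"
    "contained (addL \<sigma>) (addL \<rho>)" "contained (addT \<sigma>) (addT \<rho>)"
    "contained (addR \<sigma>) (addR \<rho>)" "contained (addB \<sigma>) (addB \<rho>)"
  using assms by (auto simp: contained_add_iff[OF contained_permutation(2)[OF assms]])

section \<open>Containment in a balloon\<close>

lemma subseq_Cons2E:
  assumes "subseq \<tau> (a # b # xs)"
  obtains "subseq \<tau> (b # xs)" | "subseq \<tau> (a # xs)" | \<upsilon> where "subseq \<upsilon> xs" "\<tau> = a # b # \<upsilon>"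
  using assms unfolding subseq_Cons_iff by blast

lemma subseq_snoc2E:
  assumes "subseq \<tau> (xs @ [c, d])"
  obtains "subseq \<tau> (xs @ [d])" | "subseq \<tau> (xs @ [c])" | \<upsilon> where "subseq \<upsilon> xs" "\<tau> = \<upsilon> @ [c, d]"
proof -
  have "subseq \<tau> ((xs @ [c]) @ [d])" using assms by simp
  then consider "subseq \<tau> (xs @ [c])" | \<upsilon> where "subseq \<upsilon> (xs @ [c])" "\<tau> = \<upsilon> @ [d]"
    unfolding subseq_snoc_iff[of _ "xs @ [c]"] by blast
  then show ?thesis
  proof cases
    case 2
    from 2(1) consider "subseq \<upsilon> xs" | \<phi> where "subseq \<phi> xs" "\<upsilon> = \<phi> @ [c]"
      unfolding subseq_snoc_iff by blast
    then show ?thesis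
    proof cases
      case 1 then show ?thesis using 2(2) that(1) by simp
    next
      case (2 \<phi>) then show ?thesis using that(3)[of \<phi>] \<open>\<tau> = \<upsilon> @ [d]\<close> by simp
    qed
  qed (use that in blast)
qed

lemma subseq_cornersE:
  assumes "subseq \<tau> ([a, b] @ xs @ [c, d])"
  obtains "subseq \<tau> ([b] @ xs @ [c, d])" | "subseq \<tau> ([a] @ xs @ [c, d])"
    | "subseq \<tau> ([a, b] @ xs @ [d])" | "subseq \<tau> ([a, b] @ xs @ [c])"
    | \<upsilon> where "subseq \<upsilon> xs" "\<tau> = [a, b] @ \<upsilon> @ [c, d]"
proof -
  from assms have "subseq \<tau> (a # b # xs @ [c, d])" by simp
  then show ?thesis
  proof (cases rule: subseq_Cons2E)
    case (3 \<upsilon>)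
    from 3(1) show ?thesis
      by (cases rule: subseq_snoc2E) (use 3(2) that in simp_all)
  qed (use that in simp_all)
qed

text \<open>
  Once one of the four outer points is gone, the others can be stripped one after another as
  extreme points, so the deletions are iterated additions of single points.
\<close>

lemma standardize_one_corner_deleted:
  fixes \<beta> defines "n \<equiv> length \<beta>" and "\<beta>2 \<equiv> map (\<lambda>v. v + 2) \<beta>"
  assumes "permutation \<beta>"
  shows "standardize ([n + 4] @ \<beta>2 @ [1, n + 3]) = addT (addR (addB \<beta>))"
    and "standardize ([2] @ \<beta>2 @ [1, n + 3]) = addR (addB (addL \<beta>))"
    and "standardize ([2, n + 4] @ \<beta>2 @ [n + 3]) = addL (addT (addR \<beta>))"
    and "standardize ([2, n + 4] @ \<beta>2 @ [1]) = addB (addL (addT \<beta>))"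
proof -
  have r: "0 < v \<and> v \<le> n" if "v \<in> set \<beta>" for v
    using permutation_range[OF assms(3) that] by (simp add: n_def)
  have relabel: "standardize (map f xs) = xs" if "permutation xs" "strict_mono f"
    for f :: "nat \<Rightarrow> nat" and xs
    using that standardize_permutation
    by (metis monotone_on_subset standardize_map subset_UNIV)
  \<comment> \<open>Opens a gap at the value \<open>k\<close>, where the deleted outer point used to be.\<close>
  let ?f = "\<lambda>k v. if k \<le> v then Suc v else (v :: nat)"
  have mono: "strict_mono (?f k)" for k by (auto simp: strict_mono_def)
  have "[n + 4] @ \<beta>2 @ [1, n + 3] = map (?f 2) (addT (addR (addB \<beta>)))"
    using r by (auto simp: add_defs \<beta>2_def n_def Suc_le_eq)
  then show "standardize ([n + 4] @ \<beta>2 @ [1, n + 3]) = addT (addR (addB \<beta>))"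
    using relabel[OF _ mono] assms(3) by simp
  have "[2] @ \<beta>2 @ [1, n + 3] = addR (addB (addL \<beta>))"
    by (auto simp: add_defs \<beta>2_def n_def)
  then show "standardize ([2] @ \<beta>2 @ [1, n + 3]) = addR (addB (addL \<beta>))"
    using standardize_permutation assms(3) by simp
  have "[2, n + 4] @ \<beta>2 @ [n + 3] = map Suc (addL (addT (addR \<beta>)))"
    by (auto simp: add_defs \<beta>2_def n_def)
  then show "standardize ([2, n + 4] @ \<beta>2 @ [n + 3]) = addL (addT (addR \<beta>))"
    using relabel[of _ Suc] assms(3) by (simp add: strict_mono_def)
  have "[2, n + 4] @ \<beta>2 @ [1] = map (?f (n + 3)) (addB (addL (addT \<beta>)))"
    using r by (fastforce simp: add_defs \<beta>2_def n_def)
  then show "standardize ([2, n + 4] @ \<beta>2 @ [1]) = addB (addL (addT \<beta>))"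
    using relabel[OF _ mono] assms(3) by simp
qed

text \<open>
  An occurrence of \<open>\<sigma>\<close> in a balloon either misses one of the four outer points, or it uses all
  of them and is then itself a balloon.
\<close>

lemma contained_balloon_iff:
  assumes "permutation \<beta>"
  shows "contained \<sigma> (balloon \<beta>) \<longleftrightarrow>
    contained \<sigma> (addB (addL (addT \<beta>))) \<or> contained \<sigma> (addL (addT (addR \<beta>))) \<or>
    contained \<sigma> (addR (addB (addL \<beta>))) \<or> contained \<sigma> (addT (addR (addB \<beta>))) \<or>
    (\<exists>\<beta>'. contained \<beta>' \<beta> \<and> \<sigma> = balloon \<beta>')"
    (is "?l \<longleftrightarrow> ?r")
proof -
  define n where "n = length \<beta>"
  define xs where "xs = map (\<lambda>v. v + 2) \<beta>"
  have bal: "balloon \<beta> = [2, n + 4] @ xs @ [1, n + 3]"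
    by (simp add: balloon_def n_def xs_def)
  have perm: "permutation (balloon \<beta>)" using assms by (rule permutation_balloon)
  have dist: "distinct ([2, n + 4] @ xs @ [1, n + 3])"
    using permutation_distinct[OF perm] bal by simp
  note del = standardize_one_corner_deleted[OF assms, folded n_def xs_def]
  have full: "standardize ([2, n + 4] @ map (\<lambda>v. v + 2) \<upsilon> @ [1, n + 3]) = balloon (standardize \<upsilon>)"
    if "subseq \<upsilon> \<beta>" for \<upsilon>
  proof -
    have "set \<upsilon> \<subseteq> set \<beta>" "distinct \<upsilon>"
      using subseq_set[OF that] subseq_distinct[OF that permutation_distinct[OF assms]] by auto
    then have "standardize ([2, n + 4] @ map (\<lambda>v. v + 2) \<upsilon> @ [1, n + 3]) =
        balloon (standardize (map (\<lambda>v. v + 2) \<upsilon>))"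
      using permutation_range[OF assms]
      by (intro standardize_balloon) (auto simp: n_def distinct_map subset_eq less_Suc_eq_le Suc_le_eq inj_on_def)
    then show ?thesis by (simp add: standardize_map strict_mono_on_def)
  qed
  show ?thesis
  proof
    assume ?l
    then obtain \<tau> where \<tau>: "subseq \<tau> ([2, n + 4] @ xs @ [1, n + 3])" "\<sigma> = standardize \<tau>"
      using contained_iff_standardize[OF perm] bal by auto
    have sub: "contained \<sigma> (standardize \<xi>)" if "subseq \<tau> \<xi>" "distinct \<xi>" for \<xi>
      using contained_standardize[OF that] \<tau>(2) by simp
    from \<tau>(1) show ?r
    proof (cases rule: subseq_cornersE)
      case 1 then show ?thesis using sub[OF 1] dist del(1) by simp
    next
      case 2 then show ?thesis using sub[OF 2] dist del(2) by simp
    next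
      case 3 then show ?thesis using sub[OF 3] dist del(3) by simp
    next
      case 4 then show ?thesis using sub[OF 4] dist del(4) by simp
    next
      case (5 \<upsilon>)
      then obtain \<phi> where "subseq \<phi> \<beta>" "\<upsilon> = map (\<lambda>v. v + 2) \<phi>"
        using subseq_map_iff xs_def by blast
      then show ?thesis
        using full[of \<phi>] 5(2) \<tau>(2) contained_iff_standardize[OF assms] by auto
    qed
  next
    assume ?r
    have corner: "contained (standardize \<xi>) (balloon \<beta>)"
      if "subseq \<xi> ([2, n + 4] @ xs @ [1, n + 3])" for \<xi>
      using that contained_iff_standardize[OF perm] bal by auto
    have "subseq ([n + 4] @ xs @ [1, n + 3]) ([2, n + 4] @ xs @ [1, n + 3])"
      "subseq ([2] @ xs @ [1, n + 3]) ([2, n + 4] @ xs @ [1, n + 3])"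
      "subseq ([2, n + 4] @ xs @ [n + 3]) ([2, n + 4] @ xs @ [1, n + 3])"
      "subseq ([2, n + 4] @ xs @ [1]) ([2, n + 4] @ xs @ [1, n + 3])"
      by (auto intro!: list_emb_append_mono)
    note this[THEN corner, unfolded del]
    moreover have "contained (balloon \<beta>') (balloon \<beta>)" if "contained \<beta>' \<beta>" for \<beta>'
    proof -
      obtain \<upsilon> where \<upsilon>: "subseq \<upsilon> \<beta>" "\<beta>' = standardize \<upsilon>"
        using \<open>contained \<beta>' \<beta>\<close> contained_iff_standardize[OF assms] by blast
      then have "subseq ([2, n + 4] @ map (\<lambda>v. v + 2) \<upsilon> @ [1, n + 3])
          ([2, n + 4] @ xs @ [1, n + 3])"
        by (auto simp: xs_def intro!: list_emb_append_mono subseq_map)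
      from corner[OF this] show ?thesis using full[OF \<upsilon>(1)] \<upsilon>(2) by simp
    qed
    ultimately show ?l
      using \<open>?r\<close> contained_trans by blast
  qed
qed

section \<open>Sum type and skew type\<close>

text \<open>
  A permutation of sum type is a direct sum with a first or last summand of size one, one of skew
  type is such a skew sum. Only these decompositions matter, since all corner deletions
  add single points.
\<close>

definition sum_type :: "nat list \<Rightarrow> bool" where
  "sum_type \<sigma> \<longleftrightarrow> (\<exists>\<rho>. \<rho> \<noteq> [] \<and> (\<sigma> = addL \<rho> \<or> \<sigma> = addR \<rho>))"

definition skew_type :: "nat list \<Rightarrow> bool" where
  "skew_type \<sigma> \<longleftrightarrow> (\<exists>\<rho>. \<rho> \<noteq> [] \<and> (\<sigma> = addT \<rho> \<or> \<sigma> = addB \<rho>))"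

lemma sum_type_ends: "sum_type \<sigma> \<Longrightarrow> 2 \<le> length \<sigma> \<and> (hd \<sigma> = 1 \<or> last \<sigma> = length \<sigma>)"
  by (auto simp: sum_type_def add_defs Suc_le_eq)

lemma skew_type_ends: "skew_type \<sigma> \<Longrightarrow> 2 \<le> length \<sigma> \<and> (hd \<sigma> = length \<sigma> \<or> last \<sigma> = 1)"
  by (auto simp: skew_type_def add_defs Suc_le_eq)

text \<open>
  Otherwise the first and the last entry would both be the minimum, or both the maximum.
\<close>

lemma sum_type_not_skew_type:
  assumes "permutation \<sigma>" "sum_type \<sigma>"
  shows "\<not> skew_type \<sigma>"
proof
  assume "skew_type \<sigma>"
  note ends = sum_type_ends[OF assms(2)] skew_type_ends[OF this]
  then have "hd \<sigma> = last \<sigma>" by auto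
  moreover from ends have ne: "\<sigma> \<noteq> []" by auto
  then have "hd \<sigma> = \<sigma> ! 0" "last \<sigma> = \<sigma> ! (length \<sigma> - 1)"
    by (simp_all add: hd_conv_nth last_conv_nth)
  ultimately have "0 = length \<sigma> - 1"
    using nth_eq_iff_index_eq[OF permutation_distinct[OF assms(1)], of 0 "length \<sigma> - 1"] ne by simp
  with ends show False by auto
qed

lemma balloon_not_type: "\<not> sum_type (balloon \<beta>)" "\<not> skew_type (balloon \<beta>)"
  by (auto dest!: sum_type_ends skew_type_ends simp: balloon_def)

text \<open>
  A permutation can only use an added point if it has an extreme point of the same kind. This is
  what makes most of the corner deletions of a balloon indistinguishable for a given \<open>\<sigma>\<close>.
\<close>

lemma contained_add_of_type:
  assumes "permutation \<rho>" "2 \<le> length \<sigma>"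
  shows "\<not> sum_type \<sigma> \<Longrightarrow> contained \<sigma> (addL \<rho>) \<longleftrightarrow> contained \<sigma> \<rho>"
    "\<not> sum_type \<sigma> \<Longrightarrow> contained \<sigma> (addR \<rho>) \<longleftrightarrow> contained \<sigma> \<rho>"
    "\<not> skew_type \<sigma> \<Longrightarrow> contained \<sigma> (addT \<rho>) \<longleftrightarrow> contained \<sigma> \<rho>"
    "\<not> skew_type \<sigma> \<Longrightarrow> contained \<sigma> (addB \<rho>) \<longleftrightarrow> contained \<sigma> \<rho>"
proof -
  have "\<rho>' \<noteq> []" if "\<sigma> = addL \<rho>' \<or> \<sigma> = addT \<rho>' \<or> \<sigma> = addR \<rho>' \<or> \<sigma> = addB \<rho>'" for \<rho>'
    using that assms(2) by auto
  then show "\<not> sum_type \<sigma> \<Longrightarrow> contained \<sigma> (addL \<rho>) \<longleftrightarrow> contained \<sigma> \<rho>"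
    "\<not> sum_type \<sigma> \<Longrightarrow> contained \<sigma> (addR \<rho>) \<longleftrightarrow> contained \<sigma> \<rho>"
    "\<not> skew_type \<sigma> \<Longrightarrow> contained \<sigma> (addT \<rho>) \<longleftrightarrow> contained \<sigma> \<rho>"
    "\<not> skew_type \<sigma> \<Longrightarrow> contained \<sigma> (addB \<rho>) \<longleftrightarrow> contained \<sigma> \<rho>"
    unfolding contained_add_iff[OF assms(1)] sum_type_def skew_type_def by blast+
qed

lemma contained_singleton_iff:
  assumes "permutation \<rho>"
  shows "contained [1] \<rho> \<longleftrightarrow> \<rho> \<noteq> []"
proof
  assume "\<rho> \<noteq> []"
  then have "subseq [hd \<rho>] \<rho>" by (cases \<rho>) auto
  moreover have "standardize [hd \<rho>] = [1]" by (simp add: standardize_def cong: conj_cong)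
  ultimately show "contained [1] \<rho>"
    using contained_iff_standardize[OF assms] by metis
qed (use contained_length_le in fastforce)

lemma contained_Nil: "permutation \<rho> \<Longrightarrow> contained [] \<rho>"
  by (simp add: contained_def order_isomorphic_def permutation_def)

lemma permutation_short: "permutation \<sigma> \<Longrightarrow> \<not> 2 \<le> length \<sigma> \<Longrightarrow> \<sigma> = [] \<or> \<sigma> = [1]"
  by (cases \<sigma>) (auto simp: permutation_def Suc_le_eq)

text \<open>
  For permutations of sum type, the deletion of the bottom point and the deletion of the top point of a
  balloon have the deletion of both as their meet. If \<open>\<sigma>\<close> uses the left point in the first
  and the right point in the second, then \<open>\<sigma> = 1 \<oplus> \<rho> \<oplus> 1\<close> or \<open>\<sigma> = 12\<close>. Removing the left
  point of \<open>1 \<oplus> \<rho> \<oplus> 1\<close> leaves \<open>\<rho> \<oplus> 1\<close>, again of sum type, which cannot use the top point.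
\<close>

lemma sum_type_meet:
  assumes "permutation \<beta>" "sum_type \<sigma>"
    and le: "contained \<sigma> (addL (addT (addR \<beta>)))" "contained \<sigma> (addR (addB (addL \<beta>)))"
  shows "contained \<sigma> (addL (addR \<beta>))"
proof -
  have \<sigma>: "permutation \<sigma>" "2 \<le> length \<sigma>" "\<not> skew_type \<sigma>"
    using contained_permutation(1)[OF le(1)] sum_type_ends[OF assms(2)]
      sum_type_not_skew_type[OF _ assms(2)] by auto
  consider "contained \<sigma> (addT (addR \<beta>))" | "contained \<sigma> (addB (addL \<beta>))"
    | \<rho> \<rho>' where "contained \<rho> (addT (addR \<beta>))" "\<sigma> = addL \<rho>" "\<sigma> = addR \<rho>'"
    using le assms(1) contained_addL_iff contained_addR_iff by (meson permutation_add)
  then show ?thesis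
  proof cases
    case 1
    then have "contained \<sigma> (addR \<beta>)" using contained_add_of_type(3) \<sigma> assms(1) by simp
    then show ?thesis by (rule contained_addI)
  next
    case 2
    then have "contained \<sigma> (addL \<beta>)" using contained_add_of_type(4) \<sigma> assms(1) by simp
    moreover have "contained (addL \<beta>) (addL (addR \<beta>))"
      using assms(1) by (simp add: contained_addI contained_refl)
    ultimately show ?thesis by (rule contained_trans)
  next
    case 3
    then have eq: "1 # map Suc \<rho> = \<rho>' @ [Suc (length \<rho>')]" by (simp add: add_defs)
    then obtain \<rho>1 where "\<rho>' = 1 # \<rho>1" and "map Suc \<rho> = \<rho>1 @ [Suc (length \<rho>')]"
      using \<sigma>(2) 3(2) by (auto simp: Cons_eq_append_conv)
    then have "map Suc \<rho> = \<rho>1 @ [Suc (Suc (length \<rho>1))]" by simp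
    then obtain \<rho>2 where \<rho>2: "\<rho> = addR \<rho>2"
      by (auto simp: map_eq_append_conv addR_def)
    have "contained \<rho> (addR \<beta>)"
    proof (cases "\<rho>2 = []")
      case True
      then show ?thesis
        using \<rho>2 contained_Nil[OF assms(1)] contained_addI(7) by blast
    next
      case False
      then have "sum_type \<rho>" using \<rho>2 sum_type_def by blast
      then show ?thesis
        using 3(1) contained_add_of_type(3)[of "addR \<beta>" \<rho>] sum_type_ends[of \<rho>]
          sum_type_not_skew_type[of \<rho>] contained_permutation(1) assms(1) by simp
    qed
    then show ?thesis using 3(2) contained_addI(5) by simp
  qed
qed

text \<open>
  The preceding lemma rotated by a quarter turn, with the roles of the left, right and of the top,
  bottom points exchanged.
\<close>

lemma skew_type_meet:
  assumes "permutation \<beta>" "skew_type \<sigma>"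
    and le: "contained \<sigma> (addB (addL (addT \<beta>)))" "contained \<sigma> (addT (addR (addB \<beta>)))"
  shows "contained \<sigma> (addT (addB \<beta>))"
proof -
  have \<sigma>: "permutation \<sigma>" "2 \<le> length \<sigma>" "\<not> sum_type \<sigma>"
    using contained_permutation(1)[OF le(1)] skew_type_ends[OF assms(2)]
      sum_type_not_skew_type assms(2) by auto
  consider "contained \<sigma> (addL (addT \<beta>))" | "contained \<sigma> (addR (addB \<beta>))"
    | \<rho> \<rho>' where "\<sigma> = addB \<rho>" "contained \<rho>' (addR (addB \<beta>))" "\<sigma> = addT \<rho>'"
    using le assms(1) contained_addB_iff contained_addT_iff by (meson permutation_add)
  then show ?thesis
  proof cases
    case 1
    then have "contained \<sigma> (addT \<beta>)" using contained_add_of_type(1) \<sigma> assms(1) by simp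
    moreover have "contained (addT \<beta>) (addT (addB \<beta>))"
      using assms(1) by (simp add: contained_addI contained_refl)
    ultimately show ?thesis by (rule contained_trans)
  next
    case 2
    then have "contained \<sigma> (addB \<beta>)" using contained_add_of_type(2) \<sigma> assms(1) by simp
    then show ?thesis by (rule contained_addI)
  next
    case 3
    then have "Suc (length \<rho>') # \<rho>' = map Suc \<rho> @ [1]" by (simp add: add_defs)
    then obtain \<rho>1 where \<rho>1: "\<rho>' = addB \<rho>1"
      using \<sigma>(2) 3(1) by (auto simp: Cons_eq_append_conv Cons_eq_map_conv addB_def)
    have "contained \<rho>' (addB \<beta>)"
    proof (cases "\<rho>1 = []")
      case True
      then show ?thesis
        using \<rho>1 contained_Nil[OF assms(1)] contained_addI(8) by blast
    next
      case False
      then have "skew_type \<rho>'" using \<rho>1 skew_type_def by blast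
      then show ?thesis
        using 3(2) contained_add_of_type(2)[of "addB \<beta>" \<rho>'] skew_type_ends[of \<rho>']
          sum_type_not_skew_type[of \<rho>'] contained_permutation(1) assms(1) by auto
    qed
    then show ?thesis using 3(3) contained_addI(6) by simp
  qed
qed

section \<open>The alternating sum over corner deletions\<close>

text \<open>
  The sum of \<open>F\<close> over the sixteen ways to keep or delete the outer points of \<open>balloon \<beta>\<close>, with
  the sign given by the parity of the number of points kept.
\<close>

definition corner_sum :: "(nat list \<Rightarrow> int) \<Rightarrow> nat list \<Rightarrow> int" where
  "corner_sum F \<beta> =
     F \<beta> - F (addL \<beta>) - F (addT \<beta>) - F (addR \<beta>) - F (addB \<beta>)
     + F (addL (addT \<beta>)) + F (addB (addL \<beta>)) + F (addL (addR \<beta>))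
     + F (addT (addR \<beta>)) + F (addT (addB \<beta>)) + F (addR (addB \<beta>))
     - F (addB (addL (addT \<beta>))) - F (addL (addT (addR \<beta>)))
     - F (addR (addB (addL \<beta>))) - F (addT (addR (addB \<beta>)))
     + F (balloon \<beta>)"

lemma corner_sum_cong:
  assumes "permutation \<beta>" "\<And>\<rho>. permutation \<rho> \<Longrightarrow> F \<rho> = G \<rho>"
  shows "corner_sum F \<beta> = corner_sum G \<beta>"
  unfolding corner_sum_def
  by (simp only: assms permutation_add permutation_balloon)

lemma corner_sum_add: "corner_sum (\<lambda>\<rho>. F \<rho> + G \<rho>) \<beta> = corner_sum F \<beta> + corner_sum G \<beta>"
  by (simp add: corner_sum_def)

lemma contained_corner_deletion:
  assumes "permutation \<beta>"
  shows "contained \<beta> (balloon \<beta>)" "contained (addL \<beta>) (balloon \<beta>)"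
    "contained (addT \<beta>) (balloon \<beta>)" "contained (addR \<beta>) (balloon \<beta>)"
    "contained (addB \<beta>) (balloon \<beta>)" "contained (addL (addT \<beta>)) (balloon \<beta>)"
    "contained (addB (addL \<beta>)) (balloon \<beta>)" "contained (addL (addR \<beta>)) (balloon \<beta>)"
    "contained (addT (addR \<beta>)) (balloon \<beta>)" "contained (addT (addB \<beta>)) (balloon \<beta>)"
    "contained (addR (addB \<beta>)) (balloon \<beta>)" "contained (addB (addL (addT \<beta>))) (balloon \<beta>)"
    "contained (addL (addT (addR \<beta>))) (balloon \<beta>)" "contained (addR (addB (addL \<beta>))) (balloon \<beta>)"
    "contained (addT (addR (addB \<beta>))) (balloon \<beta>)"
  using assms by (simp_all add: contained_balloon_iff contained_addI contained_refl)

lemma length_balloon [simp]: "length (balloon \<beta>) = length \<beta> + 4"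
  by (simp add: balloon_def)

text \<open>
  Every \<open>\<sigma>\<close> of length at least two sees only a few different permutations among the sixteen. For
  \<open>\<sigma>\<close> of sum type, an outermost top or bottom point can be dropped, and after cancellation
  in pairs only the deletions of \<open>{T, B}\<close>, \<open>{B}\<close>, \<open>{T}\<close> and \<open>{}\<close> are left, which are
  related as a meet and a join in \<open>sum_type_meet\<close>. The skew case is symmetric. If \<open>\<sigma>\<close> is of neither type,
  all proper deletions look like \<open>\<beta>\<close>, and what remains is the difference between \<open>balloon \<beta>\<close> and
  \<open>\<beta>\<close>, that is, the balloons. The correction at \<open>\<beta> = []\<close> arises because \<open>[1]\<close> lies
  below every corner deletion except \<open>[]\<close>.
\<close>

lemma corner_sum_contained:
  assumes "permutation \<beta>" "permutation \<sigma>"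
  shows "corner_sum (\<lambda>\<rho>. of_bool (contained \<sigma> \<rho>)) \<beta> =
    of_bool (\<exists>\<beta>'. contained \<beta>' \<beta> \<and> \<not> contained (balloon \<beta>') \<beta> \<and> \<sigma> = balloon \<beta>')
    - of_bool (\<beta> = [] \<and> \<sigma> = [1])"
proof (cases "2 \<le> length \<sigma>")
  case False
  then have short: "\<sigma> = [] \<or> \<sigma> = [1]" using assms(2) permutation_short by blast
  then have "\<sigma> \<noteq> balloon \<beta>'" for \<beta>' by (auto simp: balloon_def)
  moreover have "addL \<rho> \<noteq> []" "addT \<rho> \<noteq> []" "addR \<rho> \<noteq> []" "addB \<rho> \<noteq> []" "balloon \<rho> \<noteq> []" for \<rho>
    by (auto simp: add_defs balloon_def)
  ultimately show ?thesis
    using short assms(1)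
    by (elim disjE) (simp_all add: corner_sum_def contained_Nil contained_singleton_iff[unfolded One_nat_def] permutation_balloon)
next
  case len: True
  then have "\<sigma> \<noteq> [1]" by auto
  note strip = contained_add_of_type[OF _ len] permutation_add assms(1)
  note bal = contained_balloon_iff[OF assms(1), of \<sigma>]
  consider "sum_type \<sigma>" "\<not> skew_type \<sigma>" | "\<not> sum_type \<sigma>" "skew_type \<sigma>"
    | "\<not> sum_type \<sigma>" "\<not> skew_type \<sigma>"
    using sum_type_not_skew_type assms(2) by blast
  then show ?thesis
  proof cases
    case 1
    then have nb: "\<sigma> \<noteq> balloon \<beta>'" for \<beta>' using balloon_not_type by blast
    have meet: "contained \<sigma> (addL (addR \<beta>)) \<longleftrightarrow>
        contained \<sigma> (addL (addT (addR \<beta>))) \<and> contained \<sigma> (addR (addB (addL \<beta>)))"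
    proof
      assume *: "contained \<sigma> (addL (addR \<beta>))"
      have "contained (addL (addR \<beta>)) (addL (addT (addR \<beta>)))"
        using assms(1) by (simp add: contained_addI contained_refl)
      moreover have "addL (addR \<beta>) = addR (addL \<beta>)" by (simp add: add_defs)
      then have "contained (addL (addR \<beta>)) (addR (addB (addL \<beta>)))"
        using assms(1) by (simp add: contained_addI contained_refl)
      ultimately show "contained \<sigma> (addL (addT (addR \<beta>))) \<and> contained \<sigma> (addR (addB (addL \<beta>)))"
        using * contained_trans by blast
    qed (use sum_type_meet assms(1) 1 in blast)
    have "contained \<sigma> (addL (addT \<beta>)) \<longrightarrow> contained \<sigma> (addL (addT (addR \<beta>)))"
      "contained \<sigma> (addR (addB \<beta>)) \<longrightarrow> contained \<sigma> (addR (addB (addL \<beta>)))"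
      by (auto elim!: contained_trans simp: contained_addI contained_refl assms(1))
    then have "contained \<sigma> (balloon \<beta>) \<longleftrightarrow> contained \<sigma> (addL (addT (addR \<beta>))) \<or> contained \<sigma> (addR (addB (addL \<beta>)))"
      unfolding bal using nb 1 by (auto simp: strip)
    \<comment> \<open>Inclusion-exclusion for the conjunction and the disjunction of two truth values.\<close>
    then have "of_bool (contained \<sigma> (addL (addR \<beta>))) + of_bool (contained \<sigma> (balloon \<beta>)) =
        of_bool (contained \<sigma> (addL (addT (addR \<beta>)))) + (of_bool (contained \<sigma> (addR (addB (addL \<beta>)))) :: int)"
      unfolding meet by auto
    moreover have "contained \<sigma> (addT \<beta>) \<longleftrightarrow> contained \<sigma> \<beta>" "contained \<sigma> (addB \<beta>) \<longleftrightarrow> contained \<sigma> \<beta>"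
      "contained \<sigma> (addB (addL \<beta>)) \<longleftrightarrow> contained \<sigma> (addL \<beta>)"
      "contained \<sigma> (addT (addR \<beta>)) \<longleftrightarrow> contained \<sigma> (addR \<beta>)"
      "contained \<sigma> (addT (addB \<beta>)) \<longleftrightarrow> contained \<sigma> (\<beta>)"
      "contained \<sigma> (addB (addL (addT \<beta>))) \<longleftrightarrow> contained \<sigma> (addL (addT \<beta>))"
      "contained \<sigma> (addT (addR (addB \<beta>))) \<longleftrightarrow> contained \<sigma> (addR (addB \<beta>))"
      using 1 by (simp_all add: strip)
    ultimately show ?thesis
      using nb \<open>\<sigma> \<noteq> [1]\<close> by (simp add: corner_sum_def)
  next
    case 2
    then have nb: "\<sigma> \<noteq> balloon \<beta>'" for \<beta>' using balloon_not_type by blast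
    have meet: "contained \<sigma> (addT (addB \<beta>)) \<longleftrightarrow>
        contained \<sigma> (addB (addL (addT \<beta>))) \<and> contained \<sigma> (addT (addR (addB \<beta>)))"
    proof
      assume *: "contained \<sigma> (addT (addB \<beta>))"
      have "contained (addT (addB \<beta>)) (addT (addR (addB \<beta>)))"
        using assms(1) by (simp add: contained_addI contained_refl)
      moreover have "addT (addB \<beta>) = addB (addT \<beta>)" by (simp add: add_defs)
      then have "contained (addT (addB \<beta>)) (addB (addL (addT \<beta>)))"
        using assms(1) by (simp add: contained_addI contained_refl)
      ultimately show "contained \<sigma> (addB (addL (addT \<beta>))) \<and> contained \<sigma> (addT (addR (addB \<beta>)))"
        using * contained_trans by blast
    qed (use skew_type_meet assms(1) 2 in blast)
    have "contained \<sigma> (addB (addL \<beta>)) \<longrightarrow> contained \<sigma> (addB (addL (addT \<beta>)))"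
      "contained \<sigma> (addT (addR \<beta>)) \<longrightarrow> contained \<sigma> (addT (addR (addB \<beta>)))"
      by (auto elim!: contained_trans simp: contained_addI contained_refl assms(1))
    then have "contained \<sigma> (balloon \<beta>) \<longleftrightarrow> contained \<sigma> (addB (addL (addT \<beta>))) \<or> contained \<sigma> (addT (addR (addB \<beta>)))"
      unfolding bal using nb 2 by (auto simp: strip)
    then have "of_bool (contained \<sigma> (addT (addB \<beta>))) + of_bool (contained \<sigma> (balloon \<beta>)) =
        of_bool (contained \<sigma> (addB (addL (addT \<beta>)))) + (of_bool (contained \<sigma> (addT (addR (addB \<beta>)))) :: int)"
      unfolding meet by auto
    moreover have "contained \<sigma> (addL \<beta>) \<longleftrightarrow> contained \<sigma> \<beta>" "contained \<sigma> (addR \<beta>) \<longleftrightarrow> contained \<sigma> \<beta>"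
      "contained \<sigma> (addL (addT \<beta>)) \<longleftrightarrow> contained \<sigma> (addT \<beta>)"
      "contained \<sigma> (addR (addB \<beta>)) \<longleftrightarrow> contained \<sigma> (addB \<beta>)"
      "contained \<sigma> (addL (addR \<beta>)) \<longleftrightarrow> contained \<sigma> (\<beta>)"
      "contained \<sigma> (addL (addT (addR \<beta>))) \<longleftrightarrow> contained \<sigma> (addT (addR \<beta>))"
      "contained \<sigma> (addR (addB (addL \<beta>))) \<longleftrightarrow> contained \<sigma> (addB (addL \<beta>))"
      using 2 by (simp_all add: strip)
    ultimately show ?thesis
      using nb \<open>\<sigma> \<noteq> [1]\<close> by (simp add: corner_sum_def)
  next
    case 3
    have "(\<exists>\<beta>'. contained \<beta>' \<beta> \<and> \<sigma> = balloon \<beta>' \<and> \<not> contained \<sigma> \<beta>) \<longleftrightarrow>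
      (\<exists>\<beta>'. contained \<beta>' \<beta> \<and> \<not> contained (balloon \<beta>') \<beta> \<and> \<sigma> = balloon \<beta>')" by blast
    then show ?thesis
      using 3 \<open>\<sigma> \<noteq> [1]\<close> by (auto simp: corner_sum_def strip bal of_bool_def)
  qed
qed


section \<open>Sums over down-sets\<close>

definition downset_sum :: "(nat list \<Rightarrow> int) \<Rightarrow> nat list \<Rightarrow> int" where
  "downset_sum g \<rho> = (\<Sum>\<sigma> | contained \<sigma> \<rho>. g \<sigma>)"

lemma finite_downset: "finite {\<sigma>. contained \<sigma> \<rho>}"
proof (rule finite_subset)
  show "{\<sigma>. contained \<sigma> \<rho>} \<subseteq> {xs. set xs \<subseteq> {1..length \<rho>} \<and> length xs \<le> length \<rho>}"
    using contained_permutation(1) contained_length_le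
    by (auto simp: permutation_def) (meson atLeastAtMost_iff order_trans)+
qed (rule finite_lists_length_le, simp)

text \<open>
  The index set consists of those \<open>\<beta>' \<le> \<beta>\<close> whose balloon occurs in \<open>balloon \<beta>\<close> but in none of its
  proper corner deletions.
\<close>

definition balloon_sum :: "(nat list \<Rightarrow> int) \<Rightarrow> nat list \<Rightarrow> int" where
  "balloon_sum h \<beta> = (\<Sum>\<beta>' | contained \<beta>' \<beta> \<and> \<not> contained (balloon \<beta>') \<beta>. h \<beta>')"

lemma inj_balloon: "inj balloon"
  by (rule injI) (auto simp: balloon_def dest: map_injective intro: inj_onI)

lemma contained_balloon_mono: "contained \<beta>' \<beta> \<Longrightarrow> contained (balloon \<beta>') (balloon \<beta>)"
  using contained_balloon_iff contained_permutation(2) by blast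

text \<open>
  The pointwise identity \<open>corner_sum_contained\<close>, weighted by \<open>g\<close> and summed over everything below
  \<open>balloon \<beta>\<close>. Balloons are reindexed by their interior.
\<close>

lemma corner_sum_downset_sum:
  assumes "permutation \<beta>"
  shows "corner_sum (downset_sum g) \<beta> = balloon_sum (\<lambda>\<beta>'. g (balloon \<beta>')) \<beta> - of_bool (\<beta> = []) * g [1]"
proof -
  let ?D = "{\<sigma>. contained \<sigma> (balloon \<beta>)}"
  have D: "finite ?D" by (rule finite_downset)
  have S: "downset_sum g \<rho> = (\<Sum>\<sigma>\<in>?D. g \<sigma> * of_bool (contained \<sigma> \<rho>))"
    if "contained \<rho> (balloon \<beta>)" for \<rho>
    unfolding downset_sum_def of_bool_def using D
    by (intro sum.mono_neutral_cong_left) (use that contained_trans in auto)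
  have "corner_sum (downset_sum g) \<beta> =
      (\<Sum>\<sigma>\<in>?D. g \<sigma> * corner_sum (\<lambda>\<rho>. of_bool (contained \<sigma> \<rho>)) \<beta>)"
    using contained_corner_deletion[OF assms] contained_refl[OF permutation_balloon[OF assms]]
    by (simp add: corner_sum_def S algebra_simps sum.distrib sum_subtractf)
  also have "\<dots> = (\<Sum>\<sigma>\<in>?D. g \<sigma> * of_bool (\<exists>\<beta>'. contained \<beta>' \<beta> \<and> \<not> contained (balloon \<beta>') \<beta> \<and> \<sigma> = balloon \<beta>'))
      - (\<Sum>\<sigma>\<in>?D. g \<sigma> * of_bool (\<beta> = [] \<and> \<sigma> = [1]))"
    unfolding sum_subtractf[symmetric]
    by (rule sum.cong)
      (simp_all add: corner_sum_contained[OF assms contained_permutation(1)] right_diff_distrib)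
  also have "(\<Sum>\<sigma>\<in>?D. g \<sigma> * of_bool (\<exists>\<beta>'. contained \<beta>' \<beta> \<and> \<not> contained (balloon \<beta>') \<beta> \<and> \<sigma> = balloon \<beta>'))
      = sum g (balloon ` {\<beta>'. contained \<beta>' \<beta> \<and> \<not> contained (balloon \<beta>') \<beta>})"
    using D contained_balloon_mono
    by (intro sum.mono_neutral_cong_right) auto
  also have "\<dots> = balloon_sum (\<lambda>\<beta>'. g (balloon \<beta>')) \<beta>"
    unfolding balloon_sum_def
    using inj_on_subset[OF inj_balloon] by (simp add: sum.reindex)
  also have "(\<Sum>\<sigma>\<in>?D. g \<sigma> * of_bool (\<beta> = [] \<and> \<sigma> = [1])) = (\<Sum>\<sigma>\<in>{[1]}. g \<sigma> * of_bool (\<beta> = []))"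
    using D contained_singleton_iff[OF permutation_balloon[OF assms]]
    by (intro sum.mono_neutral_cong_right) (auto simp: balloon_def)
  finally show ?thesis by simp
qed

lemma downset_sum_moebius:
  assumes "permutation \<rho>"
  shows "downset_sum (moebius [1]) \<rho> = of_bool (\<rho> = [1])"
proof -
  have one: "contained [1] \<sigma> \<longleftrightarrow> \<sigma> \<noteq> []" if "contained \<sigma> \<rho>" for \<sigma>
    using contained_singleton_iff contained_permutation(1) that by blast
  have Nil: "moebius [1] [] = 0"
    using contained_length_le[of "[1]" "[]"] by (subst moebius.simps) auto
  let ?P = "{\<sigma>. contained [1] \<sigma> \<and> properly_contained \<sigma> \<rho>}"
  have fin: "finite ?P" by (rule finite_properly_contained)
  show ?thesis
  proof (cases "\<rho> = []")
    case True
    then have "{\<sigma>. contained \<sigma> \<rho>} = {[]}"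
      using assms contained_Nil by (auto dest: contained_length_le)
    then show ?thesis using True Nil by (simp add: downset_sum_def)
  next
    case False
    then have "contained [1] \<rho>" using contained_singleton_iff[OF assms] by blast
    have "{\<sigma>. contained \<sigma> \<rho>} = insert [] (insert \<rho> ?P)"
      using one contained_Nil[OF assms] contained_refl[OF assms] by (auto simp: properly_contained_def)
    moreover have "[] \<notin> ?P" "\<rho> \<notin> ?P"
      using one contained_length_le[of "[1]" "[]"] by (auto simp: properly_contained_def)
    ultimately have eq: "downset_sum (moebius [1]) \<rho> = moebius [1] \<rho> + sum (moebius [1]) ?P"
      using fin False Nil by (simp add: downset_sum_def)
    show ?thesis
    proof (cases "\<rho> = [1]")
      case True
      then have "?P = {}"
        using contained_length_le properly_contained_length_less by fastforce
      then have "sum (moebius [1]) ?P = 0" by (simp only: sum.empty)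
      moreover have "moebius [1] [1] = 1" by (subst moebius.simps) simp
      ultimately show ?thesis using eq True by simp
    next
      case False
      then show ?thesis
        using eq \<open>contained [1] \<rho>\<close> by (subst (asm) moebius.simps) simp
    qed
  qed
qed

text \<open>
  The first and the last entry of a balloon are neither its minimum nor its maximum, so it is of
  neither type and cannot use an added extreme point.
\<close>

lemma contained_balloon_add_iff:
  assumes "permutation \<rho>"
  shows "contained (balloon \<beta>) (addL \<rho>) \<longleftrightarrow> contained (balloon \<beta>) \<rho>"
    "contained (balloon \<beta>) (addT \<rho>) \<longleftrightarrow> contained (balloon \<beta>) \<rho>"
    "contained (balloon \<beta>) (addR \<rho>) \<longleftrightarrow> contained (balloon \<beta>) \<rho>"
    "contained (balloon \<beta>) (addB \<rho>) \<longleftrightarrow> contained (balloon \<beta>) \<rho>"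
  using contained_add_of_type[OF assms, of "balloon \<beta>"] balloon_not_type by simp_all

lemma contained_balloon_imp:
  assumes "contained (balloon \<beta>') \<beta>" "permutation \<beta>'"
  shows "contained \<beta>' \<beta>"
  using contained_trans[OF contained_corner_deletion(1)[OF assms(2)] assms(1)] .

text \<open>
  Nearly all corner deletions have length at least two. The exceptions are \<open>\<beta>\<close> itself and, for
  \<open>\<beta> = []\<close>, the four deletions that keep one point.
\<close>

lemma corner_sum_short_support:
  assumes F: "\<And>\<rho>. 2 \<le> length \<rho> \<Longrightarrow> F \<rho> = 0"
  shows "corner_sum F \<beta> = F \<beta> - of_bool (\<beta> = []) * (4 * F [1])"
proof (cases "\<beta> = []")
  case True
  have "addL [] = [1]" "addT [] = [1]" "addR [] = [1]" "addB [] = [1]"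
    by (simp_all add: add_defs)
  then show ?thesis using True by (simp add: corner_sum_def F)
next
  case False
  then have "Suc 0 \<le> length \<beta>" by (simp add: Suc_le_eq)
  then show ?thesis using False by (simp add: corner_sum_def F)
qed

section \<open>Sums over interiors of balloons\<close>

lemma downset_sum_split:
  "downset_sum h \<rho> = balloon_sum h \<rho> + (\<Sum>\<beta> | contained \<beta> \<rho> \<and> contained (balloon \<beta>) \<rho>. h \<beta>)"
proof -
  let ?D = "{\<beta>. contained \<beta> \<rho>}" and ?A = "{\<beta>. contained \<beta> \<rho> \<and> contained (balloon \<beta>) \<rho>}"
  have "sum h ?D = sum h (?D - ?A) + sum h ?A"
    by (rule sum.subset_diff) (auto simp: finite_downset)
  moreover have "?D - ?A = {\<beta>. contained \<beta> \<rho> \<and> \<not> contained (balloon \<beta>) \<rho>}" by blast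
  ultimately show ?thesis unfolding downset_sum_def balloon_sum_def by simp
qed

text \<open>
  The down-set sums of the Moebius function are \<open>1\<close> at \<open>[1]\<close> and \<open>0\<close> elsewhere, so the
  alternating sum sees only corner deletions equal to \<open>[1]\<close>.
\<close>

lemma balloon_sum_moebius:
  assumes "permutation \<beta>"
  shows "balloon_sum (\<lambda>\<beta>'. moebius [1] (balloon \<beta>')) \<beta> = of_bool (\<beta> = [1]) - 3 * of_bool (\<beta> = [])"
proof -
  have "corner_sum (downset_sum (moebius [1])) \<beta> = corner_sum (\<lambda>\<rho>. of_bool (\<rho> = [1])) \<beta>"
    by (rule corner_sum_cong[OF assms downset_sum_moebius])
  also have "\<dots> = of_bool (\<beta> = [1]) - 4 * of_bool (\<beta> = [])"
    by (subst corner_sum_short_support) auto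
  finally have "corner_sum (downset_sum (moebius [1])) \<beta> = of_bool (\<beta> = [1]) - 4 * of_bool (\<beta> = [])" .
  moreover have "moebius [1] [1] = 1" by (subst moebius.simps) simp
  ultimately show ?thesis
    using corner_sum_downset_sum[OF assms, of "moebius [1]"] by simp
qed

lemma contained_balloon_balloon_iff:
  assumes "permutation \<beta>"
  shows "contained \<beta>' (balloon \<beta>) \<and> contained (balloon \<beta>') (balloon \<beta>) \<longleftrightarrow> contained \<beta>' \<beta>"
proof
  assume *: "contained \<beta>' (balloon \<beta>) \<and> contained (balloon \<beta>') (balloon \<beta>)"
  then consider "contained (balloon \<beta>') \<beta>" | \<gamma> where "contained \<gamma> \<beta>" "balloon \<beta>' = balloon \<gamma>"
    using assms by (auto simp: contained_balloon_iff contained_balloon_add_iff)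
  then show "contained \<beta>' \<beta>"
  proof cases
    case 1 then show ?thesis using * contained_balloon_imp contained_permutation(1) by blast
  next
    case 2 then show ?thesis using inj_balloon by (auto dest: injD)
  qed
next
  assume "contained \<beta>' \<beta>"
  then show "contained \<beta>' (balloon \<beta>) \<and> contained (balloon \<beta>') (balloon \<beta>)"
    using contained_balloon_mono contained_trans contained_corner_deletion(1)[OF assms] by blast
qed

text \<open>
  Adding one to three outer points to \<open>\<beta>\<close> creates no new balloons, so the fifteen proper deletions contribute
  minus the sum at \<open>\<beta>\<close>. Keeping all four points, the balloons below are those of all
  \<open>\<beta>' \<le> \<beta>\<close>, so the difference consists of the \<open>\<beta>'\<close> whose balloon is not below \<open>\<beta>\<close>.
\<close>

lemma corner_sum_interior:
  assumes "permutation \<beta>"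
  shows "corner_sum (\<lambda>\<rho>. \<Sum>\<beta>' | contained \<beta>' \<rho> \<and> contained (balloon \<beta>') \<rho>. h \<beta>') \<beta> = balloon_sum h \<beta>"
proof -
  let ?K = "\<lambda>\<rho>. {\<beta>'. contained \<beta>' \<rho> \<and> contained (balloon \<beta>') \<rho>}"
  have K: "?K (addL \<rho>) = ?K \<rho>" "?K (addT \<rho>) = ?K \<rho>" "?K (addR \<rho>) = ?K \<rho>" "?K (addB \<rho>) = ?K \<rho>"
    if "permutation \<rho>" for \<rho>
    using contained_balloon_add_iff[OF that] contained_balloon_imp contained_permutation(1) contained_addI(1-4)
    by blast+
  show ?thesis
    using downset_sum_split[of h \<beta>] assms
    by (simp add: corner_sum_def K contained_balloon_balloon_iff downset_sum_def)
qed

section \<open>The Moebius function of a double balloon\<close>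

text \<open>
  The summation formula is applied to the Moebius values of balloons. The down-set sum
  splits into a part supported on lengths at most one and the part of \<open>corner_sum_interior\<close>; each
  contributes one copy of the sum on the right. The permutation \<open>[]\<close> needs the value
  \<open>\<mu>[1, 25314] = 4\<close>, which cancels the four deletions of \<open>2413\<close> to a single point.
\<close>

lemma balloon_sum_double_balloon:
  fixes h defines "h \<equiv> \<lambda>\<beta>. moebius [1] (balloon \<beta>)"
  assumes "permutation \<beta>"
  shows "balloon_sum (\<lambda>\<beta>'. h (balloon \<beta>')) \<beta> = 2 * balloon_sum h \<beta>"
proof -
  note N = balloon_sum_moebius[folded h_def]
  have "balloon_sum (\<lambda>\<beta>'. h (balloon \<beta>')) \<beta> = corner_sum (downset_sum h) \<beta> + of_bool (\<beta> = []) * h [1]"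
    using corner_sum_downset_sum[OF assms(2), of h] by simp
  also have "corner_sum (downset_sum h) \<beta> = corner_sum (balloon_sum h) \<beta> + balloon_sum h \<beta>"
    unfolding downset_sum_split[abs_def] corner_sum_add corner_sum_interior[OF assms(2)] ..
  also have "corner_sum (balloon_sum h) \<beta> = corner_sum (\<lambda>\<rho>. of_bool (\<rho> = [1]) - 3 * of_bool (\<rho> = [])) \<beta>"
    by (rule corner_sum_cong[OF assms(2) N])
  also have "\<dots> = balloon_sum h \<beta> - 4 * of_bool (\<beta> = [])"
    unfolding N[OF assms(2)]
    by (subst corner_sum_short_support) auto
  finally have *: "balloon_sum (\<lambda>\<beta>'. h (balloon \<beta>')) \<beta> =
    2 * balloon_sum h \<beta> + of_bool (\<beta> = []) * (h [1] - 4)" by (auto simp: algebra_simps)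
  \<comment> \<open>The values \<open>\<mu>[1, 2413] = -3\<close> and \<open>\<mu>[1, 25314] = 4\<close> settle the case \<open>\<beta> = []\<close>.\<close>
  have "permutation [1]" "permutation []" by (auto simp: permutation_def)
  then have nb: "\<not> contained (balloon \<rho>) [1]" "\<not> contained (balloon \<rho>) []" for \<rho>
    using contained_length_le by fastforce+
  have "{\<sigma>. contained \<sigma> [1]} = {[], [1]}"
  proof -
    have "\<sigma> = [] \<or> \<sigma> = [1]" if "contained \<sigma> [1]" for \<sigma>
      using permutation_short contained_permutation(1)[OF that] contained_length_le[OF that] by force
    then show ?thesis using contained_Nil contained_refl \<open>permutation [1]\<close> by blast
  qed
  moreover have "{\<sigma>. contained \<sigma> []} = {[]}"
    using contained_Nil \<open>permutation []\<close> by (auto dest: contained_length_le)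
  ultimately have "h [] + h [1] = 1" "h [] = -3"
    using N[OF \<open>permutation [1]\<close>] N[OF \<open>permutation []\<close>] nb by (simp_all add: balloon_sum_def)
  with * show ?thesis by simp
qed

text \<open>
  Inverts \<open>balloon_sum_double_balloon\<close>: the index set always contains \<open>\<gamma>\<close> itself, and all its other
  members are shorter.
\<close>

lemma moebius_double_balloon:
  assumes "permutation \<gamma>"
  shows "moebius [1] (balloon (balloon \<gamma>)) = 2 * moebius [1] (balloon \<gamma>)"
  using assms
proof (induction "length \<gamma>" arbitrary: \<gamma> rule: less_induct)
  case less
  let ?h = "\<lambda>\<beta>. moebius [1] (balloon \<beta>)"
  let ?A = "{\<beta>. contained \<beta> \<gamma> \<and> \<not> contained (balloon \<beta>) \<gamma>}"
  have "(\<Sum>\<beta>\<in>?A. ?h (balloon \<beta>) - 2 * ?h \<beta>) = 0"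
    using balloon_sum_double_balloon[OF less.prems]
    by (simp add: balloon_sum_def sum_subtractf sum_distrib_left)
  moreover have "(\<Sum>\<beta>\<in>?A. ?h (balloon \<beta>) - 2 * ?h \<beta>) = (\<Sum>\<beta>\<in>{\<gamma>}. ?h (balloon \<beta>) - 2 * ?h \<beta>)"
  proof (rule sum.mono_neutral_right)
    show "finite ?A" by (rule finite_subset[OF _ finite_downset[of \<gamma>]]) auto
    have "\<not> contained (balloon \<gamma>) \<gamma>" using contained_length_le by fastforce
    then show "{\<gamma>} \<subseteq> ?A" using contained_refl[OF less.prems] by blast
    show "\<forall>\<beta>\<in>?A - {\<gamma>}. ?h (balloon \<beta>) - 2 * ?h \<beta> = 0"
    proof
      fix \<beta> assume "\<beta> \<in> ?A - {\<gamma>}"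
      then have "contained \<beta> \<gamma>" "length \<beta> < length \<gamma>"
        using properly_contained_length_less by (auto simp: properly_contained_def)
      then show "?h (balloon \<beta>) - 2 * ?h \<beta> = 0"
        using less.hyps contained_permutation(1) by simp
    qed
  qed
  ultimately show ?case by simp
qed

theorem theorem61:
  fixes \<beta> \<pi> :: "nat list"
  assumes "is_balloon \<beta>"
    and "\<pi> = balloon \<beta>"
  shows "moebius [1] \<pi> = 2 * moebius [1] \<beta>"
  using assms moebius_double_balloon by (auto simp: is_balloon_def)

end
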